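(* For $n\ge2$, the assignment $\psi_n(t_i)=V_i$ ($1\le i\le n-1$) defines a representation $\psi_n:T_n\to GL_{n-1}(\Lambda)$ of the twin group, i.e. it extends to a group homomorphism.
   Context: The twin group $T_n$ is the group with generators $t_1,\dots,t_{n-1}$ and relations $t_i^2=1$ for all $1\le i\le n-1$ and $t_it_j=t_jt_i$ for $|i-j|>1$. Let $\Lambda=\mathbb{Z}(x,y)$ be the ring (field) of rational functions in $x,y$ over $\mathbb{Z}$. For $n\ge2$ and $1\le i\le n-1$, $V_i$ is the $(n-1)\times(n-1)$ matrix over $\Lambda$ that agrees with the identity matrix $I_{n-1}$ except in column $i$, where the $(i,i)$ entry is $-1$, the $(i-1,i)$ entry is $y$ (if $i\ge2$), and the $(i+1,i)$ entry is $x$ (if $i\le n-2$). In particular, $V_1=(-1)$ when $n=2$. *)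

theory Defs
  imports
    "HOL-Algebra.Group"
    "HOL-Computational_Algebra.Polynomial"
    "HOL-Computational_Algebra.Fraction_Field"
    "Jordan_Normal_Form.Matrix"
begin

section \<open>Groups given by generators and relations\<close>

text \<open>The letter \<open>(a, True)\<close> stands for the generator \<open>a\<close> and \<open>(a, False)\<close> for its formal
  inverse. A pair \<open>(u, v)\<close> of words in the second component of a presentation stands for the
  relation \<open>u = v\<close>.\<close>

type_synonym 'a word = "('a \<times> bool) list"

definition words :: "'a set \<Rightarrow> 'a word set" where
  "words S = lists (S \<times> UNIV)"

text \<open>The least congruence on words that makes \<open>(a, b)\<close> and \<open>(a, \<not> b)\<close> mutually inverse and
  contains the relations.\<close>

inductive_set word_cong :: "'a set \<Rightarrow> ('a word \<times> 'a word) set \<Rightarrow> ('a word \<times> 'a word) set"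
  for S :: "'a set" and R :: "('a word \<times> 'a word) set" where
  refl: "u \<in> words S \<Longrightarrow> (u, u) \<in> word_cong S R"
| sym: "(u, v) \<in> word_cong S R \<Longrightarrow> (v, u) \<in> word_cong S R"
| trans: "(u, v) \<in> word_cong S R \<Longrightarrow> (v, w) \<in> word_cong S R \<Longrightarrow> (u, w) \<in> word_cong S R"
| append: "(u, v) \<in> word_cong S R \<Longrightarrow> (u', v') \<in> word_cong S R
    \<Longrightarrow> (u @ u', v @ v') \<in> word_cong S R"
| cancel: "a \<in> S \<Longrightarrow> ([(a, b), (a, \<not> b)], []) \<in> word_cong S R"
| relation: "(u, v) \<in> R \<Longrightarrow> u \<in> words S \<Longrightarrow> v \<in> words S \<Longrightarrow> (u, v) \<in> word_cong S R"

definition word_class :: "'a set \<Rightarrow> ('a word \<times> 'a word) set \<Rightarrow> 'a word \<Rightarrow> 'a word set" where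
  "word_class S R w = word_cong S R `` {w}"

definition presented_group :: "'a set \<Rightarrow> ('a word \<times> 'a word) set \<Rightarrow> 'a word set monoid" where
  "presented_group S R =
     \<lparr>carrier = words S // word_cong S R,
      mult = (\<lambda>A B. \<Union>u\<in>A. \<Union>v\<in>B. word_class S R (u @ v)),
      one = word_class S R []\<rparr>"

lemma word_cong_words: "(u, v) \<in> word_cong S R \<Longrightarrow> u \<in> words S \<and> v \<in> words S"
  by (induction rule: word_cong.induct) (auto simp: words_def)

lemma equiv_word_cong: "equiv (words S) (word_cong S R)"
proof (rule equivI)
  show "word_cong S R \<subseteq> words S \<times> words S"
    using word_cong_words by fast
  show "refl_on (words S) (word_cong S R)"
    by (simp add: refl_on_def word_cong.refl)
  show "sym (word_cong S R)"
    by (rule symI) (rule word_cong.sym)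
  show "trans (word_cong S R)"
    by (rule transI) (rule word_cong.trans)
qed

lemma word_class_eq_iff:
  assumes "u \<in> words S" "v \<in> words S"
  shows "word_class S R u = word_class S R v \<longleftrightarrow> (u, v) \<in> word_cong S R"
  using assms eq_equiv_class_iff[OF equiv_word_cong] unfolding word_class_def by blast

lemma presented_group_carrier: "carrier (presented_group S R) = word_class S R ` words S"
  by (auto simp: presented_group_def word_class_def quotient_def)

lemma presented_group_mult:
  assumes "u \<in> words S" "v \<in> words S"
  shows "word_class S R u \<otimes>\<^bsub>presented_group S R\<^esub> word_class S R v = word_class S R (u @ v)"
proof -
  have *: "word_class S R (u' @ v') = word_class S R (u @ v)"
    if "u' \<in> word_class S R u" "v' \<in> word_class S R v" for u' v'
  proof -
    have "(u @ v, u' @ v') \<in> word_cong S R"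
      using that by (auto simp: word_class_def intro: word_cong.append)
    then show ?thesis
      unfolding word_class_def using equiv_class_eq[OF equiv_word_cong] by blast
  qed
  have "u \<in> word_class S R u" "v \<in> word_class S R v"
    using assms by (auto simp: word_class_def intro: word_cong.refl)
  then have "(\<Union>u'\<in>word_class S R u. \<Union>v'\<in>word_class S R v. word_class S R (u' @ v'))
      = word_class S R (u @ v)"
    using * by blast
  then show ?thesis
    by (simp add: presented_group_def)
qed

lemma presented_group_one: "\<one>\<^bsub>presented_group S R\<^esub> = word_class S R []"
  by (simp add: presented_group_def)

lemma words_Nil: "[] \<in> words S"
  and words_append: "u \<in> words S \<Longrightarrow> v \<in> words S \<Longrightarrow> u @ v \<in> words S"
  by (auto simp: words_def)

lemma word_left_inverse:
  "u \<in> words S \<Longrightarrow> \<exists>v\<in>words S. (v @ u, []) \<in> word_cong S R"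
proof (induction u)
  case Nil
  then show ?case by (auto intro: word_cong.refl words_Nil bexI[of _ "[]"])
next
  case (Cons p u)
  obtain a b where p: "p = (a, b)" by force
  from Cons.prems have aS: "a \<in> S" and uw: "u \<in> words S"
    by (auto simp: words_def p)
  from Cons.IH[OF uw] obtain v where v: "v \<in> words S" "(v @ u, []) \<in> word_cong S R" by blast
  have c: "([(a, \<not> b), (a, b)], []) \<in> word_cong S R"
    using word_cong.cancel[OF aS, of "\<not> b" R] by simp
  have "(v @ ([(a, \<not> b), (a, b)] @ u), v @ ([] @ u)) \<in> word_cong S R"
    by (intro word_cong.append c word_cong.refl v uw)
  then have "((v @ [(a, \<not> b)]) @ (p # u), []) \<in> word_cong S R"
    using word_cong.trans[OF _ v(2)] by (simp add: p)
  moreover have "v @ [(a, \<not> b)] \<in> words S"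
    using v(1) aS by (auto simp: words_def)
  ultimately show ?case by blast
qed

lemma group_presented_group: "group (presented_group S R)"
proof (rule groupI)
  fix A assume "A \<in> carrier (presented_group S R)"
  then obtain u where u: "u \<in> words S" "A = word_class S R u"
    by (auto simp: presented_group_carrier)
  obtain v where v: "v \<in> words S" "(v @ u, []) \<in> word_cong S R"
    using word_left_inverse[OF u(1)] by blast
  have "word_class S R v \<otimes>\<^bsub>presented_group S R\<^esub> A = \<one>\<^bsub>presented_group S R\<^esub>"
    using u v by (simp add: presented_group_mult presented_group_one word_class_eq_iff
        words_append words_Nil)
  then show "\<exists>B\<in>carrier (presented_group S R). B \<otimes>\<^bsub>presented_group S R\<^esub> A
      = \<one>\<^bsub>presented_group S R\<^esub>"
    using v(1) by (auto simp: presented_group_carrier)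
next
  fix A B C
  assume "A \<in> carrier (presented_group S R)" "B \<in> carrier (presented_group S R)"
    "C \<in> carrier (presented_group S R)"
  then obtain u v w where "u \<in> words S" "A = word_class S R u" "v \<in> words S"
    "B = word_class S R v" "w \<in> words S" "C = word_class S R w"
    unfolding presented_group_carrier by (elim imageE)
  then show "A \<otimes>\<^bsub>presented_group S R\<^esub> B \<otimes>\<^bsub>presented_group S R\<^esub> C
      = A \<otimes>\<^bsub>presented_group S R\<^esub> (B \<otimes>\<^bsub>presented_group S R\<^esub> C)"
    by (simp add: presented_group_mult words_append)
next
  fix A B
  assume "A \<in> carrier (presented_group S R)" "B \<in> carrier (presented_group S R)"
  then obtain u v where "u \<in> words S" "A = word_class S R u" "v \<in> words S"
    "B = word_class S R v"
    unfolding presented_group_carrier by (elim imageE)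
  then show "A \<otimes>\<^bsub>presented_group S R\<^esub> B \<in> carrier (presented_group S R)"
    by (simp add: presented_group_carrier presented_group_mult words_append)
next
  show "\<one>\<^bsub>presented_group S R\<^esub> \<in> carrier (presented_group S R)"
    by (simp add: presented_group_carrier presented_group_one words_Nil)
next
  fix A
  assume "A \<in> carrier (presented_group S R)"
  then obtain u where "u \<in> words S" "A = word_class S R u"
    unfolding presented_group_carrier by (elim imageE)
  then show "\<one>\<^bsub>presented_group S R\<^esub> \<otimes>\<^bsub>presented_group S R\<^esub> A = A"
    by (simp add: presented_group_one presented_group_mult words_Nil)
qed


section \<open>The twin group\<close>

definition twin_relations :: "nat \<Rightarrow> (nat word \<times> nat word) set" where
  "twin_relations n =
     {([(i, True), (i, True)], []) | i. i \<in> {1..n - 1}} \<union>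
     {([(i, True), (j, True)], [(j, True), (i, True)]) | i j.
        i \<in> {1..n - 1} \<and> j \<in> {1..n - 1} \<and> \<bar>int i - int j\<bar> > 1}"

definition twin_group :: "nat \<Rightarrow> nat word set monoid" where
  "twin_group n = presented_group {1..n - 1} (twin_relations n)"

definition twin_gen :: "nat \<Rightarrow> nat \<Rightarrow> nat word set" where
  "twin_gen n i = word_class {1..n - 1} (twin_relations n) [(i, True)]"


section \<open>The matrices\<close>

text \<open>Rational functions in two variables, as the fraction field of \<open>\<int>[x][y]\<close>: the inner
  polynomial variable is \<open>x\<close>, the outer one is \<open>y\<close>.\<close>

type_synonym ratfun = "int poly poly fract"

definition varx :: ratfun where
  "varx = Fract [:[:0, 1:]:] 1"

definition vary :: ratfun where
  "vary = Fract [:0, 1:] 1"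

definition GL :: "nat \<Rightarrow> ratfun mat monoid" where
  "GL m = units_of (ring_mat TYPE(ratfun) m ())"

text \<open>Rows and columns are counted from \<open>1\<close> here, while the indices of \<^const>\<open>mat\<close>
  start at \<open>0\<close>.\<close>

definition twin_mat :: "nat \<Rightarrow> nat \<Rightarrow> ratfun mat" where
  "twin_mat n i = mat (n - 1) (n - 1) (\<lambda>(r0, c0).
     let r = r0 + 1; c = c0 + 1 in
     if c = i then
       (if r = i then - 1 else if r + 1 = i then vary else if r = i + 1 then varx else 0)
     else (if r = c then 1 else 0))"

end

theory Submission
  imports Defs
begin

text \<open>
  A homomorphism out of a group given by generators and relations is the same thing as a choice of
  images of the generators that satisfies the relations (\<open>presented_group_universal\<close>). So the
  claim is a computation with the matrices \<open>V\<^sub>i\<close>.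

  Each \<open>V\<^sub>i\<close> is a rank one perturbation of the identity: \<open>V\<^sub>i = I + u\<^sub>i e\<^sub>i\<^sup>T\<close>, where the column
  \<open>u\<^sub>i\<close> has entry \<open>-2\<close> in position \<open>i\<close>, entries \<open>y\<close> and \<open>x\<close> next to it, and zeros elsewhere. Hence
  \<open>V\<^sub>i V\<^sub>j = I + u\<^sub>i e\<^sub>i\<^sup>T + u\<^sub>j e\<^sub>j\<^sup>T + (e\<^sub>i\<^sup>T u\<^sub>j) u\<^sub>i e\<^sub>j\<^sup>T\<close>. For \<open>i = j\<close> the scalar \<open>e\<^sub>i\<^sup>T u\<^sub>i = -2\<close>
  cancels the two middle terms, so that \<open>V\<^sub>i\<close> is an involution, and in particular invertible. For
  \<open>\<bar>i - j\<bar> > 1\<close> the scalar \<open>e\<^sub>i\<^sup>T u\<^sub>j\<close> is zero and the expression is symmetric in \<open>i\<close> and \<open>j\<close>.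
\<close>

section \<open>Homomorphisms out of a presented group\<close>

context group
begin

definition letter_val :: "('x \<Rightarrow> 'a) \<Rightarrow> 'x \<times> bool \<Rightarrow> 'a" where
  "letter_val f p = (if snd p then f (fst p) else inv (f (fst p)))"

definition word_val :: "('x \<Rightarrow> 'a) \<Rightarrow> 'x word \<Rightarrow> 'a" where
  "word_val f w = foldr (\<lambda>p g. letter_val f p \<otimes> g) w \<one>"

lemma word_val_Nil [simp]: "word_val f [] = \<one>"
  and word_val_Cons [simp]: "word_val f (p # w) = letter_val f p \<otimes> word_val f w"
  by (simp_all add: word_val_def)

lemma letter_val_closed:
  assumes "f \<in> S \<rightarrow> carrier G" "p \<in> S \<times> UNIV"
  shows "letter_val f p \<in> carrier G"
  using assms by (auto simp: letter_val_def)

lemma word_val_closed: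
  assumes "f \<in> S \<rightarrow> carrier G" "w \<in> words S"
  shows "word_val f w \<in> carrier G"
  using assms(2)
proof (induction w)
  case (Cons p w)
  then show ?case
    using letter_val_closed[OF assms(1), of p] by (simp add: words_def)
qed simp

lemma word_val_append:
  assumes f: "f \<in> S \<rightarrow> carrier G" and "u \<in> words S" and v: "v \<in> words S"
  shows "word_val f (u @ v) = word_val f u \<otimes> word_val f v"
  using assms(2)
proof (induction u)
  case Nil
  then show ?case using word_val_closed[OF f v] by simp
next
  case (Cons p u)
  then have "p \<in> S \<times> UNIV" "u \<in> words S" by (auto simp: words_def)
  with Cons.IH show ?case
    using letter_val_closed[OF f, of p] word_val_closed[OF f, of u] word_val_closed[OF f v]
    by (simp add: m_assoc)
qed

text \<open>Having the same value is itself a congruence that contains the relations and cancels inverse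
  letters, while \<^const>\<open>word_cong\<close> is the least such congruence.\<close>

lemma word_val_cong:
  assumes f: "f \<in> S \<rightarrow> carrier G"
    and rel: "\<And>u v. (u, v) \<in> R \<Longrightarrow> word_val f u = word_val f v"
    and "(u, v) \<in> word_cong S R"
  shows "word_val f u = word_val f v"
  using assms(3)
proof (induction rule: word_cong.induct)
  case (append u v u' v')
  then show ?case
    using word_cong_words[OF append.hyps(1)] word_cong_words[OF append.hyps(2)]
    by (simp add: word_val_append[OF f])
next
  case (cancel a b)
  then have "f a \<in> carrier G" using f by auto
  then show ?case by (simp add: letter_val_def)
qed (auto simp: rel)

theorem presented_group_universal:
  assumes f: "f \<in> S \<rightarrow> carrier G"
    and rel: "\<And>u v. (u, v) \<in> R \<Longrightarrow> word_val f u = word_val f v"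
  obtains h where "group_hom (presented_group S R) G h"
    and "\<And>a. a \<in> S \<Longrightarrow> h (word_class S R [(a, True)]) = f a"
proof -
  define h where "h A = word_val f (SOME u. u \<in> A)" for A
  have h: "h (word_class S R u) = word_val f u" if "u \<in> words S" for u
  proof -
    have "u \<in> word_class S R u"
      using that by (simp add: word_class_def word_cong.refl)
    then have "(SOME v. v \<in> word_class S R u) \<in> word_class S R u"
      by (rule someI)
    then have "(u, SOME v. v \<in> word_class S R u) \<in> word_cong S R"
      by (simp add: word_class_def)
    from word_val_cong[OF f rel this] show ?thesis
      by (simp add: h_def)
  qed
  have "h \<in> hom (presented_group S R) G"
  proof (rule homI)
    fix A assume "A \<in> carrier (presented_group S R)"
    then show "h A \<in> carrier G"
      by (auto simp: presented_group_carrier h word_val_closed[OF f])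
  next
    fix A B assume "A \<in> carrier (presented_group S R)" "B \<in> carrier (presented_group S R)"
    then show "h (A \<otimes>\<^bsub>presented_group S R\<^esub> B) = h A \<otimes> h B"
      by (auto simp: presented_group_carrier presented_group_mult h words_append
          word_val_append[OF f])
  qed
  then have "group_hom (presented_group S R) G h"
    by (simp add: group_hom_def group_hom_axioms_def group_presented_group group_axioms)
  moreover have "h (word_class S R [(a, True)]) = f a" if "a \<in> S" for a
  proof -
    have "f a \<in> carrier G" using f that by auto
    then show ?thesis using that by (simp add: h words_def letter_val_def)
  qed
  ultimately show thesis by (rule that)
qed

end


section \<open>The relations for the matrices\<close>

text \<open>The column \<open>u\<^sub>i = (V\<^sub>i - I) e\<^sub>i\<close>; positions are counted from \<open>1\<close>.\<close>

definition twin_col :: "nat \<Rightarrow> nat \<Rightarrow> ratfun" where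
  "twin_col i r = (if r = i then - 2 else if r + 1 = i then vary else if r = i + 1 then varx else 0)"

lemma twin_mat_carrier [simp]: "twin_mat n i \<in> carrier_mat (n - 1) (n - 1)"
  by (simp add: twin_mat_def)

lemma twin_mat_dim [simp]: "dim_row (twin_mat n i) = n - 1" "dim_col (twin_mat n i) = n - 1"
  by (simp_all add: twin_mat_def)

text \<open>This is \<open>V\<^sub>i = I + u\<^sub>i e\<^sub>i\<^sup>T\<close>.\<close>

lemma twin_mat_entry:
  assumes "r < n - 1" "c < n - 1"
  shows "twin_mat n i $$ (r, c) =
    (if r = c then 1 else 0) + (if c + 1 = i then twin_col i (r + 1) else 0)"
  using assms by (auto simp: twin_mat_def twin_col_def)

text \<open>Multiplication by \<open>V\<^sub>i\<close> from the left is a row operation: it adds to \<open>M\<close> the product of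
  \<open>u\<^sub>i\<close> with row \<open>i\<close> of \<open>M\<close>, and this row has index \<open>i - 1\<close> when counted from \<open>0\<close>.\<close>

lemma twin_mat_mult_entry:
  assumes "i \<in> {1..n - 1}" "M \<in> carrier_mat (n - 1) (n - 1)" "r < n - 1" "c < n - 1"
  shows "(twin_mat n i * M) $$ (r, c) = M $$ (r, c) + twin_col i (r + 1) * M $$ (i - 1, c)"
proof -
  have i: "k + 1 = i \<longleftrightarrow> k = i - 1" for k
    using assms(1) by auto
  have "(twin_mat n i * M) $$ (r, c) = (\<Sum>k<n - 1. twin_mat n i $$ (r, k) * M $$ (k, c))"
    using assms by (simp add: scalar_prod_def atLeast0LessThan)
  also have "\<dots> = (\<Sum>k<n - 1. (if r = k then M $$ (k, c) else 0)
      + (if k = i - 1 then twin_col i (r + 1) * M $$ (k, c) else 0))"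
    using assms by (intro sum.cong) (auto simp: twin_mat_entry i distrib_right)
  also have "\<dots> = M $$ (r, c) + twin_col i (r + 1) * M $$ (i - 1, c)"
    using assms by (auto simp: sum.distrib)
  finally show ?thesis .
qed

lemma twin_mat_involution:
  assumes "i \<in> {1..n - 1}"
  shows "twin_mat n i * twin_mat n i = 1\<^sub>m (n - 1)"
proof (rule eq_matI)
  fix r c assume "r < dim_row (1\<^sub>m (n - 1))" "c < dim_col (1\<^sub>m (n - 1))"
  then show "(twin_mat n i * twin_mat n i) $$ (r, c) = 1\<^sub>m (n - 1) $$ (r, c)"
    using assms
    by (auto simp: twin_mat_mult_entry twin_mat_entry twin_col_def[of i i] simp del: One_nat_def index_mult_mat(1))
qed simp_all

lemma twin_mat_commute:
  assumes i: "i \<in> {1..n - 1}" and j: "j \<in> {1..n - 1}" and far: "\<bar>int i - int j\<bar> > 1"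
  shows "twin_mat n i * twin_mat n j = twin_mat n j * twin_mat n i"
proof (rule eq_matI)
  have "twin_col i j = 0" "twin_col j i = 0" "i \<noteq> j"
    using far by (auto simp: twin_col_def)
  moreover fix r c
  assume "r < dim_row (twin_mat n j * twin_mat n i)" "c < dim_col (twin_mat n j * twin_mat n i)"
  ultimately show "(twin_mat n i * twin_mat n j) $$ (r, c) = (twin_mat n j * twin_mat n i) $$ (r, c)"
    using i j
    by (auto simp: twin_mat_mult_entry twin_mat_entry simp del: One_nat_def index_mult_mat(1))
qed simp_all


section \<open>The representation\<close>

lemma group_GL: "group (GL m)"
proof -
  interpret ring "ring_mat TYPE(ratfun) m ()" by (rule ring_mat)
  show ?thesis unfolding GL_def by (rule units_group)
qed

lemma GL_mult: "A \<otimes>\<^bsub>GL m\<^esub> B = A * B"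
  and GL_one: "\<one>\<^bsub>GL m\<^esub> = 1\<^sub>m m"
  by (simp_all add: GL_def units_of_def ring_mat_simps)

lemma twin_mat_in_GL:
  assumes "i \<in> {1..n - 1}"
  shows "twin_mat n i \<in> carrier (GL (n - 1))"
  using twin_mat_involution[OF assms] twin_mat_carrier[of n i]
  by (auto simp: GL_def units_of_def Units_def ring_mat_simps)

theorem proposition3p2:
  fixes n :: nat
  assumes "n \<ge> 2"
  shows "\<exists>\<psi>. group_hom (twin_group n) (GL (n - 1)) \<psi> \<and>
           (\<forall>i\<in>{1..n - 1}. \<psi> (twin_gen n i) = twin_mat n i)"
proof -
  interpret GL: group "GL (n - 1)" by (rule group_GL)
  have f: "twin_mat n \<in> {1..n - 1} \<rightarrow> carrier (GL (n - 1))"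
    using twin_mat_in_GL by blast
  have rel: "GL.word_val (twin_mat n) u = GL.word_val (twin_mat n) v"
    if "(u, v) \<in> twin_relations n" for u v
    using that unfolding twin_relations_def
    by (auto simp: GL.letter_val_def GL_mult GL_one twin_mat_involution twin_mat_commute
        right_mult_one_mat[OF twin_mat_carrier] simp del: One_nat_def)
  obtain h where "group_hom (presented_group {1..n - 1} (twin_relations n)) (GL (n - 1)) h"
    and "\<And>i. i \<in> {1..n - 1} \<Longrightarrow>
      h (word_class {1..n - 1} (twin_relations n) [(i, True)]) = twin_mat n i"
    using GL.presented_group_universal[OF f rel] by blast
  then show ?thesis
    unfolding twin_group_def twin_gen_def by blast
qed

end
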